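(* Let $\lambda>0$ and $R\ge0$. Under the identification of $\mathrm{Pol}(\mathbb S^2_\lambda)$ with $\mathcal R_{SU(2)}$, the reduction-$T_R$-topology and the quotient-$T_{2R}$-topology agree.
   Context: Let $(H,X,Y)$ be the standard basis of $\mathfrak{sl}_2(\mathbb C)$, $B$ the Killing form ($B(H,H)=8$, $B(X,Y)=4$), $Z^\flat=B(Z,\cdot)$. Let $\mu=\frac{\mathrm i\lambda}{8}H\in\mathfrak{su}_2$, $\mathbb S^2_\lambda=\{\mathrm{Ad}_k\mu:k\in SU(2)\}$, $\psi_\mu(k)=\mathrm{Ad}_k\mu$. $\mathrm{Pol}(\mathbb S^2_\lambda)$ is the algebra of restrictions to $\mathbb S^2_\lambda$ of complex-valued polynomials on $\mathfrak{su}_2$. Write $k=\begin{pmatrix}u&-\bar v\\ v&\bar u\end{pmatrix}\in SU(2)$. $\mathcal R_{SU(2)}$ is the algebra of functions on $SU(2)$ generated by $A:k\mapsto|u|^2-|v|^2$, $B:k\mapsto\bar uv$, $C:k\mapsto u\bar v$. The map $p\mapsto p\circ\psi_\mu$ is an algebra isomorphism $\mathrm{Pol}(\mathbb S^2_\lambda)\to\mathcal R_{SU(2)}$ (sending $H^\flat,X^\flat,Y^\flat$ to $\mathrm i\lambda A,\mathrm i\lambda B,\mathrm i\lambda C$), used as an identification. $T_R$-topology: for a finite-dimensional complex vector space $V$ with basis $e_1,\dots,e_n$ and corresponding $1$-norm, it is the locally convex topology on $\mathrm S^\bullet(V)$ given by the norms $(C\|\cdot\|_1)_R\big(\sum_{I\in\mathbb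 N_0^n}a_Ie_1^{I_1}\cdots e_n^{I_n}\big)=\sum_I(|I|!)^RC^{|I|}|a_I|$, $C\ge1$. Reduction-$T_R$-topology: let $\hat U,\hat{\overline U},\hat V,\hat{\overline V}:\mathbb C^2\to\mathbb C$ be $(z_1,z_2)\mapsto z_1,\bar z_1,z_2,\bar z_2$, and let $\mathcal P_{\mathbb C^2}$ be the polynomial algebra they generate (the symmetric algebra over their span) with the $T_R$-topology for this basis. Let $\mathcal R_{\mathbb C^2}\subseteq\mathcal P_{\mathbb C^2}$ be the subalgebra generated by $\hat U\hat{\overline U}-\hat V\hat{\overline V}$, $\hat{\overline U}\hat V$, $\hat U\hat{\overline V}$, $\hat U\hat{\overline U}+\hat V\hat{\overline V}$, with the subspace topology. Composition with $k\mapsto(u,v)$ maps $\mathcal R_{\mathbb C^2}$ onto $\mathcal R_{SU(2)}$; the reduction-$T_R$-topology on $\mathcal R_{SU(2)}$ is the quotient topology. Quotient-$T_R$-topology: give $\mathrm{Pol}(\mathfrak{sl}_2(\mathbb C))\cong\mathrm S^\bullet(\mathfrak{sl}_2(\mathbb C)^* )$ the $T_R$-topology for the basis $H^\flat,X^\flat,Y^\flat$. Let $\mathcal I_{\mathrm{van}}$ be the ideal of those polynomials vanishing on $\mathbb S^2_\lambda$; restriction identifies $\mathrm{Pol}(\mathfrak{sl}_2(\mathbb C))/\mathcal I_{\mathrm{van}}$ with $\mathrm{Pol}(\mathbb S^2_\lambda)$, and the quotient-$T_R$-topology is the quotient topology. *)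

theory Defs
  imports
    "HOL-Analysis.Analysis"
    "HOL-Library.Poly_Mapping"
    "HOL-Library.Function_Algebras"
begin

section \<open>Symmetric algebras over spaces with a finite basis\<close>

text \<open>The symmetric algebra over a complex vector space with basis indexed by the finite type
  \<open>'n\<close>: the element \<open>p\<close> has the coefficient \<open>Poly_Mapping.lookup p I\<close> at the monomial with multi-index \<open>I\<close>.\<close>

type_synonym 'n sym_alg = "('n \<Rightarrow>\<^sub>0 nat) \<Rightarrow>\<^sub>0 complex"

definition mdeg :: "('n::finite \<Rightarrow>\<^sub>0 nat) \<Rightarrow> nat" where
  "mdeg I = (\<Sum>i\<in>UNIV. Poly_Mapping.lookup I i)"

definition scalar :: "complex \<Rightarrow> 'n::finite sym_alg" where
  "scalar c = Poly_Mapping.single 0 c"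

definition gen :: "'n \<Rightarrow> 'n::finite sym_alg" where
  "gen i = Poly_Mapping.single (Poly_Mapping.single i 1) 1"

definition eval :: "('n \<Rightarrow> complex) \<Rightarrow> 'n::finite sym_alg \<Rightarrow> complex" where
  "eval x p = (\<Sum>I\<in>Poly_Mapping.keys p. Poly_Mapping.lookup p I * (\<Prod>i\<in>UNIV. x i ^ Poly_Mapping.lookup I i))"

inductive_set generated_algebra :: "(complex \<Rightarrow> 'a::comm_ring_1) \<Rightarrow> 'a set \<Rightarrow> 'a set"
  for \<iota> :: "complex \<Rightarrow> 'a" and S :: "'a set" where
  scalar: "\<iota> c \<in> generated_algebra \<iota> S"
| gen: "a \<in> S \<Longrightarrow> a \<in> generated_algebra \<iota> S"
| add: "a \<in> generated_algebra \<iota> S \<Longrightarrow> b \<in> generated_algebra \<iota> S \<Longrightarrow> a + b \<in> generated_algebra \<iota> S"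
| mult: "a \<in> generated_algebra \<iota> S \<Longrightarrow> b \<in> generated_algebra \<iota> S \<Longrightarrow> a * b \<in> generated_algebra \<iota> S"


section \<open>Topologies\<close>

definition locally_convex_topology :: "('a::ab_group_add \<Rightarrow> real) set \<Rightarrow> 'a topology" where
  "locally_convex_topology P =
     topology_generated_by {{b. p (b - a) < e} | p a e. p \<in> P \<and> e > 0}"

definition TR_norm :: "real \<Rightarrow> real \<Rightarrow> 'n::finite sym_alg \<Rightarrow> real" where
  "TR_norm R C p = (\<Sum>I\<in>Poly_Mapping.keys p. fact (mdeg I) powr R * C ^ mdeg I * norm (Poly_Mapping.lookup p I))"

definition TR_topology :: "real \<Rightarrow> 'n::finite sym_alg topology" where
  "TR_topology R = locally_convex_topology {TR_norm R C | C. C \<ge> 1}"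

definition quotient_topology :: "'a topology \<Rightarrow> ('a \<Rightarrow> 'b) \<Rightarrow> 'b set \<Rightarrow> 'b topology" where
  "quotient_topology T f Q =
     topology (\<lambda>U. U \<subseteq> Q \<and> openin T {a \<in> topspace T. f a \<in> U})"


section \<open>The Lie algebras and the sphere\<close>

type_synonym mat2 = "complex^2^2"

definition bracket :: "mat2 \<Rightarrow> mat2 \<Rightarrow> mat2" where
  "bracket Z W = Z ** W - W ** Z"

datatype sl2_gen = Hf | Xf | Yf

fun sl2_basis :: "sl2_gen \<Rightarrow> mat2" where
  "sl2_basis Hf = vector [vector [1, 0], vector [0, -1]]"
| "sl2_basis Xf = vector [vector [0, 1], vector [0, 0]]"
| "sl2_basis Yf = vector [vector [0, 0], vector [1, 0]]"

fun sl2_coord :: "sl2_gen \<Rightarrow> mat2 \<Rightarrow> complex" where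
  "sl2_coord Hf Z = Z $ 1 $ 1"
| "sl2_coord Xf Z = Z $ 1 $ 2"
| "sl2_coord Yf Z = Z $ 2 $ 1"

instance sl2_gen :: finite
proof
  have "(UNIV :: sl2_gen set) = {Hf, Xf, Yf}"
    using sl2_gen.exhaust by auto
  then show "finite (UNIV :: sl2_gen set)"
    by (metis finite.emptyI finite_insert)
qed

text \<open>The trace of \<open>ad Z \<circ> ad W\<close> on the trace-free matrices, computed in the basis \<open>H, X, Y\<close>.\<close>

definition killing :: "mat2 \<Rightarrow> mat2 \<Rightarrow> complex" where
  "killing Z W = (\<Sum>g\<in>UNIV. sl2_coord g (bracket Z (bracket W (sl2_basis g))))"

definition flat :: "mat2 \<Rightarrow> mat2 \<Rightarrow> complex" where
  "flat Z = (\<lambda>W. killing Z W)"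

definition ctranspose :: "mat2 \<Rightarrow> mat2" where
  "ctranspose k = map_matrix cnj (transpose k)"

definition su2 :: "mat2 set" where
  "su2 = {Z. ctranspose Z = - Z \<and> trace Z = 0}"

definition SU2 :: "mat2 set" where
  "SU2 = {k. k ** ctranspose k = mat 1 \<and> det k = 1}"

definition Ad :: "mat2 \<Rightarrow> mat2 \<Rightarrow> mat2" where
  "Ad k Z = k ** Z ** matrix_inv k"

definition mu :: "real \<Rightarrow> mat2" where
  "mu lam = map_matrix (\<lambda>z. (\<i> * complex_of_real lam / 8) * z) (sl2_basis Hf)"

definition psi :: "real \<Rightarrow> mat2 \<Rightarrow> mat2" where
  "psi lam k = Ad k (mu lam)"

definition S2 :: "real \<Rightarrow> mat2 set" where
  "S2 lam = psi lam ` SU2"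


section \<open>The function algebras\<close>

text \<open>Functions on a set \<open>D\<close> of matrices are represented by their extensional versions
  \<open>restrict f D\<close>. A polynomial on the real subspace \<open>su2\<close> is the restriction of a (real) polynomial
  on the space of all matrices.\<close>

definition Pol_su2 :: "(mat2 \<Rightarrow> complex) set" where
  "Pol_su2 = {restrict p su2 | p. polynomial_function p}"

definition Pol_S2 :: "real \<Rightarrow> (mat2 \<Rightarrow> complex) set" where
  "Pol_S2 lam = {restrict p (S2 lam) | p. p \<in> Pol_su2}"

definition entry_u :: "mat2 \<Rightarrow> complex" where "entry_u k = k $ 1 $ 1"
definition entry_v :: "mat2 \<Rightarrow> complex" where "entry_v k = k $ 2 $ 1"

definition fun_A :: "mat2 \<Rightarrow> complex" where
  "fun_A k = complex_of_real ((cmod (entry_u k))\<^sup>2 - (cmod (entry_v k))\<^sup>2)"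
definition fun_B :: "mat2 \<Rightarrow> complex" where
  "fun_B k = cnj (entry_u k) * entry_v k"
definition fun_C :: "mat2 \<Rightarrow> complex" where
  "fun_C k = entry_u k * cnj (entry_v k)"

definition R_SU2 :: "(mat2 \<Rightarrow> complex) set" where
  "R_SU2 = {restrict f SU2 | f. f \<in> generated_algebra (\<lambda>c _. c) {fun_A, fun_B, fun_C}}"

definition identification :: "real \<Rightarrow> (mat2 \<Rightarrow> complex) \<Rightarrow> (mat2 \<Rightarrow> complex)" where
  "identification lam p = restrict (p \<circ> psi lam) SU2"


section \<open>The reduction topology\<close>

datatype C2_gen = U_hat | Ubar_hat | V_hat | Vbar_hat

instance C2_gen :: finite
proof
  have "(UNIV :: C2_gen set) = {U_hat, Ubar_hat, V_hat, Vbar_hat}"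
    using C2_gen.exhaust by auto
  then show "finite (UNIV :: C2_gen set)"
    by (metis finite.emptyI finite_insert)
qed

fun C2_fun :: "complex \<times> complex \<Rightarrow> C2_gen \<Rightarrow> complex" where
  "C2_fun (z\<^sub>1, z\<^sub>2) U_hat = z\<^sub>1"
| "C2_fun (z\<^sub>1, z\<^sub>2) Ubar_hat = cnj z\<^sub>1"
| "C2_fun (z\<^sub>1, z\<^sub>2) V_hat = z\<^sub>2"
| "C2_fun (z\<^sub>1, z\<^sub>2) Vbar_hat = cnj z\<^sub>2"

definition R_C2 :: "C2_gen sym_alg set" where
  "R_C2 = generated_algebra scalar
     {gen U_hat * gen Ubar_hat - gen V_hat * gen Vbar_hat,
      gen Ubar_hat * gen V_hat,
      gen U_hat * gen Vbar_hat,
      gen U_hat * gen Ubar_hat + gen V_hat * gen Vbar_hat}"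

definition C2_to_SU2 :: "C2_gen sym_alg \<Rightarrow> (mat2 \<Rightarrow> complex)" where
  "C2_to_SU2 p = restrict (\<lambda>k. eval (C2_fun (entry_u k, entry_v k)) p) SU2"

definition reduction_TR_topology :: "real \<Rightarrow> (mat2 \<Rightarrow> complex) topology" where
  "reduction_TR_topology R = quotient_topology (subtopology (TR_topology R) R_C2) C2_to_SU2 R_SU2"


section \<open>The quotient topology\<close>

definition sl2_poly :: "sl2_gen sym_alg \<Rightarrow> (mat2 \<Rightarrow> complex)" where
  "sl2_poly p = (\<lambda>Z. eval (\<lambda>g. flat (sl2_basis g) Z) p)"

definition I_van :: "real \<Rightarrow> sl2_gen sym_alg set" where
  "I_van lam = {p. \<forall>Z\<in>S2 lam. sl2_poly p Z = 0}"

text \<open>The fibres of restriction to the sphere are the cosets of \<open>I_van\<close>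
  (lemma \<open>sl2_to_S2_eq_iff\<close>) and its image is \<open>Pol_S2\<close> (lemma \<open>sl2_to_S2_image\<close>), so that
  \<open>quotient_topology\<close> along it is the topology of the quotient by \<open>I_van\<close>.\<close>

definition sl2_to_S2 :: "real \<Rightarrow> sl2_gen sym_alg \<Rightarrow> (mat2 \<Rightarrow> complex)" where
  "sl2_to_S2 lam p = restrict (sl2_poly p) (S2 lam)"

definition quotient_TR_topology :: "real \<Rightarrow> real \<Rightarrow> (mat2 \<Rightarrow> complex) topology" where
  "quotient_TR_topology lam R = quotient_topology (TR_topology R) (sl2_to_S2 lam) (Pol_S2 lam)"


section \<open>Well-definedness\<close>

lemma UNIV_sl2_gen: "UNIV = {Hf, Xf, Yf}"
  using sl2_gen.exhaust by auto

lemma UNIV_C2_gen: "UNIV = {U_hat, Ubar_hat, V_hat, Vbar_hat}"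
  using C2_gen.exhaust by auto

lemma openin_quotient_topology:
  "openin (quotient_topology T f Q) U \<longleftrightarrow> U \<subseteq> Q \<and> openin T {a \<in> topspace T. f a \<in> U}"
proof -
  have "istopology (\<lambda>U. U \<subseteq> Q \<and> openin T {a \<in> topspace T. f a \<in> U})"
    unfolding istopology_def
  proof (intro conjI allI impI)
    fix U V assume U: "U \<subseteq> Q \<and> openin T {a \<in> topspace T. f a \<in> U}"
      and V: "V \<subseteq> Q \<and> openin T {a \<in> topspace T. f a \<in> V}"
    then show "U \<inter> V \<subseteq> Q" by blast
    have "{a \<in> topspace T. f a \<in> U \<inter> V} = {a \<in> topspace T. f a \<in> U} \<inter> {a \<in> topspace T. f a \<in> V}"
      by blast
    then show "openin T {a \<in> topspace T. f a \<in> U \<inter> V}"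
      using U V by auto
  next
    fix K assume K: "\<forall>U\<in>K. U \<subseteq> Q \<and> openin T {a \<in> topspace T. f a \<in> U}"
    then show "\<Union>K \<subseteq> Q" by blast
    have "{a \<in> topspace T. f a \<in> \<Union>K} = (\<Union>U\<in>K. {a \<in> topspace T. f a \<in> U})"
      by blast
    then show "openin T {a \<in> topspace T. f a \<in> \<Union>K}"
      using K by auto
  qed
  then show ?thesis
    by (simp add: quotient_topology_def topology_inverse')
qed

lemma quotient_map_quotient_topology:
  assumes "f ` topspace T = Q"
  shows "topspace (quotient_topology T f Q) = Q" "quotient_map T (quotient_topology T f Q) f"
proof -
  have "{a \<in> topspace T. f a \<in> Q} = topspace T"
    using assms by blast
  then have "openin (quotient_topology T f Q) Q"
    by (simp add: openin_quotient_topology)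
  then show top: "topspace (quotient_topology T f Q) = Q"
    by (meson openin_quotient_topology openin_subset openin_topspace subset_antisym)
  show "quotient_map T (quotient_topology T f Q) f"
    using assms by (auto simp: quotient_map_def top openin_quotient_topology)
qed

lemma topspace_TR_topology: "topspace (TR_topology R) = UNIV"
proof -
  have "a \<in> \<Union>{{b. p (b - a) < e} | p a e. p \<in> {TR_norm R C | C. C \<ge> 1} \<and> e > 0}"
    for a :: "'n::finite sym_alg"
  proof -
    have "a \<in> {b. TR_norm R 1 (b - a) < 1}"
      by (simp add: TR_norm_def)
    moreover have "{b. TR_norm R 1 (b - a) < 1}
        \<in> {{b. p (b - a) < e} | p a e. p \<in> {TR_norm R C | C. C \<ge> 1} \<and> e > 0}"
      by (rule CollectI, rule exI[of _ "TR_norm R 1"], rule exI[of _ a], rule exI[of _ 1]) auto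
    ultimately show ?thesis by (rule UnionI[rotated])
  qed
  then show ?thesis
    unfolding TR_topology_def locally_convex_topology_def topology_generated_by_topspace by blast
qed

lemma eval_superset:
  assumes "finite S" "Poly_Mapping.keys p \<subseteq> S"
  shows "eval x p = (\<Sum>I\<in>S. Poly_Mapping.lookup p I * (\<Prod>i\<in>UNIV. x i ^ Poly_Mapping.lookup I i))"
  unfolding eval_def using assms
  by (intro sum.mono_neutral_left) (auto simp: in_keys_iff)

lemma eval_single: "eval x (Poly_Mapping.single I c) = c * (\<Prod>i\<in>UNIV. x i ^ Poly_Mapping.lookup I i)"
  by (simp add: eval_superset[of "{I}"] lookup_single)

lemma eval_add: "eval x (p + q) = eval x p + eval x q"
proof -
  let ?S = "Poly_Mapping.keys p \<union> Poly_Mapping.keys q"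
  have "Poly_Mapping.keys (p + q) \<subseteq> ?S" by (rule keys_add)
  then show ?thesis
    by (simp add: eval_superset[of ?S] lookup_add distrib_right sum.distrib)
qed

lemma eval_zero: "eval x 0 = 0"
  by (simp add: eval_def)

lemma eval_diff: "eval x (p - q) = eval x p - eval x q"
  using eval_add[of x "p - q" q] by simp

lemma sym_alg_induct [case_names zero single add]:
  fixes p :: "'n::finite sym_alg"
  assumes "P 0" "\<And>I c. P (Poly_Mapping.single I c)" "\<And>p q. P p \<Longrightarrow> P q \<Longrightarrow> P (p + q)"
  shows "P p"
proof (induction p rule: update_induct)
  case const
  then show ?case using assms(1) by simp
next
  case (update p I c)
  have "Poly_Mapping.update I c p = p + Poly_Mapping.single I c"
    using update(1) by (intro poly_mapping_eqI) (auto simp: lookup_update lookup_add lookup_single in_keys_iff when_def)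
  then show ?case using assms(2,3) update by simp
qed

lemma eval_mult: "eval x (p * q) = eval x p * eval x q"
proof (induction p rule: sym_alg_induct)
  case (single I c)
  show ?case
    by (induction q rule: sym_alg_induct)
      (simp_all add: eval_zero eval_single mult_single lookup_add power_add prod.distrib
        eval_add distrib_left)
qed (simp_all add: eval_zero eval_add distrib_right)

lemma eval_scalar: "eval x (scalar c) = c"
  by (simp add: scalar_def eval_single)

lemma eval_gen: "eval x (gen i) = x i"
proof -
  have "(\<Prod>j\<in>UNIV. x j ^ Poly_Mapping.lookup (Poly_Mapping.single i (1::nat)) j) = (\<Prod>j\<in>UNIV. if i = j then x j else 1)"
    by (intro prod.cong) (auto simp: lookup_single when_def)
  then show ?thesis
    by (simp add: gen_def eval_single)
qed

lemma mat2_eq_iff: "(Z::mat2) = W \<longleftrightarrow>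
    Z$1$1 = W$1$1 \<and> Z$1$2 = W$1$2 \<and> Z$2$1 = W$2$1 \<and> Z$2$2 = W$2$2"
  by (auto simp: vec_eq_iff forall_2)

lemma mat2_mult: "((Z::mat2) ** W) $ i $ j = Z$i$1 * W$1$j + Z$i$2 * W$2$j"
  by (simp add: matrix_matrix_mult_def sum_2)

lemma sl2_basis_entries:
  "sl2_basis Hf $ 1 $ 1 = 1" "sl2_basis Hf $ 1 $ 2 = 0" "sl2_basis Hf $ 2 $ 1 = 0" "sl2_basis Hf $ 2 $ 2 = -1"
  "sl2_basis Xf $ 1 $ 1 = 0" "sl2_basis Xf $ 1 $ 2 = 1" "sl2_basis Xf $ 2 $ 1 = 0" "sl2_basis Xf $ 2 $ 2 = 0"
  "sl2_basis Yf $ 1 $ 1 = 0" "sl2_basis Yf $ 1 $ 2 = 0" "sl2_basis Yf $ 2 $ 1 = 1" "sl2_basis Yf $ 2 $ 2 = 0"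
  by (simp_all add: vector_2)

lemma flat_entries:
  "flat (sl2_basis Hf) Z = 4 * (Z$1$1 - Z$2$2)"
  "flat (sl2_basis Xf) Z = 4 * Z$2$1"
  "flat (sl2_basis Yf) Z = 4 * Z$1$2"
  by (simp_all add: flat_def killing_def UNIV_sl2_gen bracket_def mat2_mult sl2_basis_entries
      algebra_simps del: sl2_basis.simps)

lemma killing_basis:
  "killing (sl2_basis Hf) (sl2_basis Hf) = 8"
  "killing (sl2_basis Xf) (sl2_basis Yf) = 4"
  by (simp_all add: flat_entries[unfolded flat_def] sl2_basis_entries del: sl2_basis.simps)

lemma SU2_entries:
  assumes "k \<in> SU2"
  shows "k$1$2 = - cnj (k$2$1)" "k$2$2 = cnj (k$1$1)"
    "k$1$1 * cnj (k$1$1) + k$2$1 * cnj (k$2$1) = 1" "matrix_inv k = ctranspose k"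
proof -
  have r: "k ** ctranspose k = mat 1" and d: "k$1$1 * k$2$2 - k$1$2 * k$2$1 = 1"
    using assms by (auto simp: SU2_def det_2)
  then have l: "ctranspose k ** k = mat 1"
    by (simp add: matrix_left_right_inverse)
  show "matrix_inv k = ctranspose k"
  proof -
    have "k ** matrix_inv k = mat 1 \<and> matrix_inv k ** k = mat 1"
      unfolding matrix_inv_def by (rule someI[of _ "ctranspose k"]) (use l r in blast)
    then show ?thesis
      by (metis l matrix_mul_assoc matrix_mul_lid matrix_mul_rid)
  qed
  have e: "cnj (k$1$1) * k$1$1 + cnj (k$2$1) * k$2$1 = 1" "cnj (k$1$1) * k$1$2 + cnj (k$2$1) * k$2$2 = 0"
    using l by (simp_all add: mat2_eq_iff mat2_mult ctranspose_def transpose_def mat_def)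
  show "k$1$1 * cnj (k$1$1) + k$2$1 * cnj (k$2$1) = 1"
    using e(1) by (simp add: mult.commute)
  show "k$1$2 = - cnj (k$2$1)" "k$2$2 = cnj (k$1$1)"
    using e d by algebra+
qed

lemma flat_psi:
  assumes "k \<in> SU2"
  shows "flat (sl2_basis Hf) (psi lam k) = \<i> * lam * fun_A k"
    "flat (sl2_basis Xf) (psi lam k) = \<i> * lam * fun_B k"
    "flat (sl2_basis Yf) (psi lam k) = \<i> * lam * fun_C k"
  by (simp_all add: flat_entries psi_def Ad_def mu_def SU2_entries[OF assms] mat2_mult
      ctranspose_def transpose_def sl2_basis_entries fun_A_def fun_B_def fun_C_def
      entry_u_def entry_v_def complex_norm_square field_simps del: sl2_basis.simps of_real_power)

lemma S2_subset_su2: "S2 lam \<subseteq> su2"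
proof
  fix Z assume "Z \<in> S2 lam"
  then obtain k where k: "k \<in> SU2" and Z: "Z = psi lam k"
    by (auto simp: S2_def)
  show "Z \<in> su2"
    by (simp add: Z su2_def psi_def Ad_def mu_def SU2_entries[OF k] mat2_mult mat2_eq_iff trace_def sum_2
      ctranspose_def transpose_def sl2_basis_entries field_simps del: sl2_basis.simps)
qed

lemma sl2_to_S2_eq_iff: "sl2_to_S2 lam p = sl2_to_S2 lam q \<longleftrightarrow> p - q \<in> I_van lam"
  by (auto simp: sl2_to_S2_def I_van_def sl2_poly_def eval_diff restrict_def fun_eq_iff)

lemma C2_to_SU2_image: "C2_to_SU2 ` R_C2 = R_SU2"
proof
  have "\<exists>f \<in> generated_algebra (\<lambda>c _. c) {fun_A, fun_B, fun_C}.
      \<forall>k\<in>SU2. eval (C2_fun (entry_u k, entry_v k)) p = f k" if "p \<in> R_C2" for p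
    using that unfolding R_C2_def
  proof (induction p rule: generated_algebra.induct)
    case (scalar c)
    then show ?case
      by (intro bexI[of _ "\<lambda>_. c"]) (auto simp: eval_scalar intro: generated_algebra.scalar)
  next
    case (gen a)
    then show ?case
    proof (elim insertE emptyE)
      assume "a = gen U_hat * gen Ubar_hat - gen V_hat * gen Vbar_hat"
      then show ?thesis
        by (intro bexI[of _ fun_A] generated_algebra.gen)
          (auto simp: eval_diff eval_mult eval_gen fun_A_def complex_norm_square simp del: of_real_power)
    next
      assume "a = gen Ubar_hat * gen V_hat"
      then show ?thesis
        by (intro bexI[of _ fun_B] generated_algebra.gen) (auto simp: eval_mult eval_gen fun_B_def)
    next
      assume "a = gen U_hat * gen Vbar_hat"
      then show ?thesis
        by (intro bexI[of _ fun_C] generated_algebra.gen) (auto simp: eval_mult eval_gen fun_C_def)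
    next
      assume "a = gen U_hat * gen Ubar_hat + gen V_hat * gen Vbar_hat"
      then show ?thesis
        by (intro bexI[of _ "\<lambda>_. 1"] generated_algebra.scalar)
          (auto simp: eval_add eval_mult eval_gen entry_u_def entry_v_def SU2_entries)
    qed
  next
    case (add a b)
    then obtain f g where "f \<in> generated_algebra (\<lambda>c _. c) {fun_A, fun_B, fun_C}"
      "g \<in> generated_algebra (\<lambda>c _. c) {fun_A, fun_B, fun_C}"
      "\<forall>k\<in>SU2. eval (C2_fun (entry_u k, entry_v k)) a = f k"
      "\<forall>k\<in>SU2. eval (C2_fun (entry_u k, entry_v k)) b = g k" by blast
    then show ?case
      by (intro bexI[of _ "f + g"]) (auto simp: eval_add intro: generated_algebra.add)
  next
    case (mult a b)
    then obtain f g where "f \<in> generated_algebra (\<lambda>c _. c) {fun_A, fun_B, fun_C}"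
      "g \<in> generated_algebra (\<lambda>c _. c) {fun_A, fun_B, fun_C}"
      "\<forall>k\<in>SU2. eval (C2_fun (entry_u k, entry_v k)) a = f k"
      "\<forall>k\<in>SU2. eval (C2_fun (entry_u k, entry_v k)) b = g k" by blast
    then show ?case
      by (intro bexI[of _ "f * g"]) (auto simp: eval_mult intro: generated_algebra.mult)
  qed
  then show "C2_to_SU2 ` R_C2 \<subseteq> R_SU2"
    unfolding C2_to_SU2_def R_SU2_def by (auto intro: restrict_ext) (meson restrict_ext)
next
  have "\<exists>p \<in> R_C2. \<forall>k. eval (C2_fun (entry_u k, entry_v k)) p = f k"
    if "f \<in> generated_algebra (\<lambda>c _. c) {fun_A, fun_B, fun_C}" for f
    using that
  proof (induction f rule: generated_algebra.induct)
    case (scalar c)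
    then show ?case
      by (intro bexI[of _ "Defs.scalar c"])
        (auto simp: eval_scalar R_C2_def intro: generated_algebra.scalar)
  next
    case (gen f)
    then show ?case
    proof (elim insertE emptyE)
      assume "f = fun_A"
      then show ?thesis
        by (intro bexI[of _ "Defs.gen U_hat * Defs.gen Ubar_hat - Defs.gen V_hat * Defs.gen Vbar_hat"])
          (auto simp: eval_diff eval_mult eval_gen fun_A_def complex_norm_square R_C2_def
            intro: generated_algebra.gen simp del: of_real_power)
    next
      assume "f = fun_B"
      then show ?thesis
        by (intro bexI[of _ "Defs.gen Ubar_hat * Defs.gen V_hat"])
          (auto simp: eval_mult eval_gen fun_B_def R_C2_def intro: generated_algebra.gen)
    next
      assume "f = fun_C"
      then show ?thesis
        by (intro bexI[of _ "Defs.gen U_hat * Defs.gen Vbar_hat"])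
          (auto simp: eval_mult eval_gen fun_C_def R_C2_def intro: generated_algebra.gen)
    qed
  next
    case (add f g)
    then obtain p q where "p \<in> R_C2" "q \<in> R_C2"
      "\<forall>k. eval (C2_fun (entry_u k, entry_v k)) p = f k"
      "\<forall>k. eval (C2_fun (entry_u k, entry_v k)) q = g k" by blast
    then show ?case
      by (intro bexI[of _ "p + q"]) (auto simp: eval_add R_C2_def intro: generated_algebra.add)
  next
    case (mult f g)
    then obtain p q where "p \<in> R_C2" "q \<in> R_C2"
      "\<forall>k. eval (C2_fun (entry_u k, entry_v k)) p = f k"
      "\<forall>k. eval (C2_fun (entry_u k, entry_v k)) q = g k" by blast
    then show ?case
      by (intro bexI[of _ "p * q"]) (auto simp: eval_mult R_C2_def intro: generated_algebra.mult)
  qed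
  note lift = this
  show "R_SU2 \<subseteq> C2_to_SU2 ` R_C2"
  proof
    fix h assume "h \<in> R_SU2"
    then obtain f where f: "f \<in> generated_algebra (\<lambda>c _. c) {fun_A, fun_B, fun_C}"
      and h: "h = restrict f SU2"
      unfolding R_SU2_def by blast
    obtain p where p: "p \<in> R_C2" "\<forall>k. eval (C2_fun (entry_u k, entry_v k)) p = f k"
      using lift[OF f] by blast
    then have "h = C2_to_SU2 p"
      by (simp add: h C2_to_SU2_def)
    with p show "h \<in> C2_to_SU2 ` R_C2" by blast
  qed
qed

lemma polynomial_function_complex:
  "polynomial_function (f :: mat2 \<Rightarrow> complex) \<longleftrightarrow>
     real_polynomial_function (\<lambda>Z. Re (f Z)) \<and> real_polynomial_function (\<lambda>Z. Im (f Z))"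
  unfolding polynomial_function_iff_Basis_inner by (auto simp: Basis_complex_def)

lemma polynomial_function_complex_mult:
  fixes f g :: "mat2 \<Rightarrow> complex"
  assumes "polynomial_function f" "polynomial_function g"
  shows "polynomial_function (\<lambda>Z. f Z * g Z)"
  using assms unfolding polynomial_function_complex
  by (auto intro!: real_polynomial_function.intros(3,4) real_polynomial_function_diff)

lemma polynomial_function_sl2_poly: "polynomial_function (sl2_poly p)"
proof (induction p rule: sym_alg_induct)
  case zero
  then show ?case by (simp add: sl2_poly_def eval_zero)
next
  case (add p q)
  then show ?case by (auto simp: sl2_poly_def eval_add)
next
  case (single I c)
  have entry: "polynomial_function (\<lambda>Z::mat2. Z $ i $ j)" for i j
    by (intro polynomial_function_bounded_linear bounded_linear_vec_nth
        bounded_linear_compose[OF bounded_linear_vec_nth])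
  have lin: "polynomial_function (\<lambda>Z. flat (sl2_basis g) Z)" for g
    by (cases g) (auto simp only: flat_entries intro!: polynomial_function_complex_mult
        polynomial_function_const entry polynomial_function_diff)
  have pow: "polynomial_function (\<lambda>Z. flat (sl2_basis g) Z ^ n)" for g n
    by (induction n) (auto intro!: polynomial_function_complex_mult lin)
  show ?case
    unfolding sl2_poly_def eval_single UNIV_sl2_gen
    by (auto intro!: polynomial_function_complex_mult pow simp del: sl2_basis.simps)
qed

lemma real_polynomial_su2:
  assumes "real_polynomial_function f"
  shows "\<exists>p. \<forall>Z\<in>su2. sl2_poly p Z = complex_of_real (f Z)"
  using assms
proof (induction f rule: real_polynomial_function.induct)
  case (linear f)
  define E1 :: mat2 where "E1 = vector [vector [\<i>, 0], vector [0, -\<i>]]"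
  define E2 :: mat2 where "E2 = vector [vector [0, 1], vector [-1, 0]]"
  define E3 :: mat2 where "E3 = vector [vector [0, \<i>], vector [\<i>, 0]]"
  define p where "p = scalar (f E1 / (8 * \<i>)) * gen Hf
    + scalar (f E2 / 8) * (gen Yf - gen Xf) + scalar (f E3 / (8 * \<i>)) * (gen Yf + gen Xf)"
  have "sl2_poly p Z = f Z" if "Z \<in> su2" for Z
  proof -
    have z: "cnj (Z$1$1) = - Z$1$1" "cnj (Z$2$1) = - Z$1$2" "Z$2$2 = - Z$1$1"
      using that by (auto simp: su2_def mat2_eq_iff ctranspose_def transpose_def trace_def sum_2
          add_eq_0_iff)
    define a b c where "a = Im (Z$1$1)" and "b = Re (Z$1$2)" and "c = Im (Z$1$2)"
    have Z11: "Z$1$1 = \<i> * a" and Z12: "Z$1$2 = b + \<i> * c" and Z21: "Z$2$1 = - b + \<i> * c"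
      using z by (auto simp: a_def b_def c_def complex_eq_iff)
    have "Z = a *\<^sub>R E1 + b *\<^sub>R E2 + c *\<^sub>R E3"
      by (simp add: mat2_eq_iff E1_def E2_def E3_def Z11 Z12 Z21 z(3) vector_2 complex_eq_iff)
    then have "f Z = a * f E1 + b * f E2 + c * f E3"
      using linear by (simp add: bounded_linear.linear linear_add linear_scale)
    then show ?thesis
      by (simp add: p_def sl2_poly_def eval_add eval_diff eval_mult eval_scalar eval_gen flat_entries
          Z11 Z12 Z21 z(3) field_simps del: sl2_basis.simps)
  qed
  then show ?case by blast
next
  case (const c)
  then show ?case by (intro exI[of _ "scalar c"]) (simp add: sl2_poly_def eval_scalar)
next
  case (add f g)
  then obtain p q where "\<forall>Z\<in>su2. sl2_poly p Z = f Z" "\<forall>Z\<in>su2. sl2_poly q Z = g Z" by blast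
  then show ?case by (intro exI[of _ "p + q"]) (simp add: sl2_poly_def eval_add)
next
  case (mult f g)
  then obtain p q where "\<forall>Z\<in>su2. sl2_poly p Z = f Z" "\<forall>Z\<in>su2. sl2_poly q Z = g Z" by blast
  then show ?case by (intro exI[of _ "p * q"]) (simp add: sl2_poly_def eval_mult)
qed

lemma sl2_to_S2_image: "range (sl2_to_S2 lam) = Pol_S2 lam"
proof
  show "range (sl2_to_S2 lam) \<subseteq> Pol_S2 lam"
  proof clarify
    fix p
    have "sl2_to_S2 lam p = restrict (restrict (sl2_poly p) su2) (S2 lam)"
      using S2_subset_su2[of lam] by (auto simp: sl2_to_S2_def restrict_def fun_eq_iff)
    then show "sl2_to_S2 lam p \<in> Pol_S2 lam"
      using polynomial_function_sl2_poly unfolding Pol_S2_def Pol_su2_def by blast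
  qed
  show "Pol_S2 lam \<subseteq> range (sl2_to_S2 lam)"
  proof
    fix h assume "h \<in> Pol_S2 lam"
    then obtain f where f: "polynomial_function f" and h: "h = restrict (restrict f su2) (S2 lam)"
      unfolding Pol_S2_def Pol_su2_def by blast
    obtain p q where pq: "\<forall>Z\<in>su2. sl2_poly p Z = Re (f Z)" "\<forall>Z\<in>su2. sl2_poly q Z = Im (f Z)"
      using f real_polynomial_su2 unfolding polynomial_function_complex by meson
    have "\<forall>Z\<in>su2. sl2_poly (p + scalar \<i> * q) Z = f Z"
      using pq by (simp add: sl2_poly_def eval_add eval_mult eval_scalar complex_eq_iff)
    then have "h = sl2_to_S2 lam (p + scalar \<i> * q)"
      using S2_subset_su2[of lam] by (auto simp: h sl2_to_S2_def restrict_def fun_eq_iff)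
    then show "h \<in> range (sl2_to_S2 lam)" by blast
  qed
qed

lemma quotient_map_reduction:
  "topspace (reduction_TR_topology R) = R_SU2"
  "quotient_map (subtopology (TR_topology R) R_C2) (reduction_TR_topology R) C2_to_SU2"
  unfolding reduction_TR_topology_def
  by (intro quotient_map_quotient_topology; simp add: topspace_TR_topology C2_to_SU2_image)+

lemma quotient_map_quotient:
  "topspace (quotient_TR_topology lam R) = Pol_S2 lam"
  "quotient_map (TR_topology R) (quotient_TR_topology lam R) (sl2_to_S2 lam)"
  unfolding quotient_TR_topology_def
  by (intro quotient_map_quotient_topology; simp add: topspace_TR_topology sl2_to_S2_image)+

end

theory Submission
  imports Defs
begin

text \<open>Both topologies are quotients, so it suffices to lift the identification and its inverse to
  continuous linear maps between the algebras upstairs. In one direction, \<open>H\<^sup>\<flat>, X\<^sup>\<flat>, Y\<^sup>\<flat>\<close> are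
  sent to \<open>\<i>\<lambda>\<close> times the quadratic generators of \<open>\<R>\<^bsub>\<complex>\<^sup>2\<^esub>\<close>. In the other, a monomial of
  \<open>\<R>\<^bsub>\<complex>\<^sup>2\<^esub>\<close> contains as many unbarred as barred variables, hence is a product of \<open>n\<close> factors
  \<open>|U|\<^sup>2, |V|\<^sup>2, cnj U V, U cnj V\<close>, which on \<open>SU(2)\<close> are the affine functions
  \<open>(1 + A)/2, (1 - A)/2, B, C\<close>. Degree \<open>n\<close> on the sphere corresponds to degree \<open>2n\<close> on \<open>\<complex>\<^sup>2\<close>, and
  \<open>(n!)\<^sup>2 \<le> (2n)! \<le> 4\<^sup>n (n!)\<^sup>2\<close> turns \<open>T\<^bsub>2R\<^esub>\<close> into \<open>T\<^bsub>R\<^esub>\<close>.\<close>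

section \<open>Weighted norms on symmetric algebras\<close>

lemma TR_norm_superset:
  assumes "finite S" "Poly_Mapping.keys p \<subseteq> S"
  shows "TR_norm R C p =
    (\<Sum>I\<in>S. fact (mdeg I) powr R * C ^ mdeg I * norm (Poly_Mapping.lookup p I))"
  unfolding TR_norm_def using assms
  by (intro sum.mono_neutral_left) (auto simp: in_keys_iff)

lemma TR_norm_single:
  "TR_norm R C (Poly_Mapping.single I c) = fact (mdeg I) powr R * C ^ mdeg I * norm c"
  by (simp add: TR_norm_superset[of "{I}"] lookup_single)

lemma TR_norm_zero: "TR_norm R C 0 = 0"
  by (simp add: TR_norm_def)

lemma TR_norm_nonneg: "C \<ge> 0 \<Longrightarrow> TR_norm R C p \<ge> 0"
  by (auto simp: TR_norm_def intro!: sum_nonneg)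

lemma TR_norm_triangle:
  assumes "C \<ge> 0"
  shows "TR_norm R C (p + q) \<le> TR_norm R C p + TR_norm R C q"
proof -
  let ?S = "Poly_Mapping.keys p \<union> Poly_Mapping.keys q"
  have "Poly_Mapping.keys (p + q) \<subseteq> ?S" by (rule keys_add)
  then show ?thesis
    using assms
    by (simp add: TR_norm_superset[of ?S] lookup_add flip: sum.distrib)
      (intro sum_mono, simp add: mult_left_mono norm_triangle_ineq flip: distrib_left)
qed

lemma TR_norm_sum:
  assumes "C \<ge> 0"
  shows "TR_norm R C (\<Sum>a\<in>A. f a) \<le> (\<Sum>a\<in>A. TR_norm R C (f a))"
proof (induction A rule: infinite_finite_induct)
  case (insert a A)
  then show ?case
    using TR_norm_triangle[OF assms, of R "f a" "sum f A"] by simp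
qed (simp_all add: TR_norm_zero)

lemma sym_alg_eq_sum:
  "p = (\<Sum>I\<in>Poly_Mapping.keys p. Poly_Mapping.single I (Poly_Mapping.lookup p I))"
proof (rule poly_mapping_eqI)
  fix J
  show "Poly_Mapping.lookup p J = Poly_Mapping.lookup
    (\<Sum>I\<in>Poly_Mapping.keys p. Poly_Mapping.single I (Poly_Mapping.lookup p I)) J"
    by (simp add: lookup_sum lookup_single when_def in_keys_iff)
qed

lemma mdeg_add: "mdeg (I + J) = mdeg I + mdeg J"
  by (simp add: mdeg_def lookup_add sum.distrib)

lemma mdeg_zero: "mdeg 0 = 0"
  by (simp add: mdeg_def)

lemma mdeg_single: "mdeg (Poly_Mapping.single i n) = n"
  by (simp add: mdeg_def lookup_single when_def)

text \<open>At \<open>R = 0\<close> the weight \<open>C ^ mdeg I\<close> is multiplicative in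
  \<open>I\<close>. For \<open>R > 0\<close> the factorials break submultiplicativity, so products
  are estimated here and the factorials restored afterwards through the degree.\<close>

lemma TR_norm_0_mult:
  assumes "C \<ge> 0"
  shows "TR_norm 0 C (p * q) \<le> TR_norm 0 C p * TR_norm 0 C q"
proof -
  let ?l = Poly_Mapping.lookup and ?s = Poly_Mapping.single
  let ?P = "Poly_Mapping.keys p" and ?Q = "Poly_Mapping.keys q"
  have "p * q = (\<Sum>I\<in>?P. ?s I (?l p I)) * (\<Sum>J\<in>?Q. ?s J (?l q J))"
    by (simp flip: sym_alg_eq_sum)
  also have "\<dots> = (\<Sum>I\<in>?P. \<Sum>J\<in>?Q. ?s (I + J) (?l p I * ?l q J))"
    by (simp add: sum_product mult_single)
  finally have "TR_norm 0 C (p * q)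
      \<le> (\<Sum>I\<in>?P. \<Sum>J\<in>?Q. TR_norm 0 C (?s (I + J) (?l p I * ?l q J)))"
    by (auto intro!: order_trans[OF TR_norm_sum[OF assms]] sum_mono)
  also have "\<dots> = TR_norm 0 C p * TR_norm 0 C q"
    by (simp add: TR_norm_single TR_norm_def[of 0 C p] TR_norm_def[of 0 C q] sum_product mdeg_add
        power_add norm_mult mult_ac)
  finally show ?thesis .
qed

lemma TR_norm_scalar_mult:
  assumes "C \<ge> 0"
  shows "TR_norm R C (scalar c * p) \<le> norm c * TR_norm R C p"
proof -
  let ?l = Poly_Mapping.lookup and ?s = Poly_Mapping.single
  let ?P = "Poly_Mapping.keys p"
  have "scalar c * p = (\<Sum>I\<in>?P. ?s I (c * ?l p I))"
    by (subst sym_alg_eq_sum[of p]) (simp add: scalar_def sum_distrib_left mult_single)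
  then have "TR_norm R C (scalar c * p) \<le> (\<Sum>I\<in>?P. TR_norm R C (?s I (c * ?l p I)))"
    using TR_norm_sum[OF assms] by metis
  also have "\<dots> = norm c * TR_norm R C p"
    by (simp add: TR_norm_single TR_norm_def[of R C p] sum_distrib_left norm_mult mult_ac)
  finally show ?thesis .
qed

text \<open>The two bounds are carried together because they are exactly what controls all \<open>T\<^sub>R\<close>-norms.\<close>

definition bounded_by :: "real \<Rightarrow> nat \<Rightarrow> real \<Rightarrow> 'n::finite sym_alg \<Rightarrow> bool" where
  "bounded_by C d K p \<longleftrightarrow> (\<forall>I\<in>Poly_Mapping.keys p. mdeg I \<le> d) \<and> TR_norm 0 C p \<le> K"

lemma bounded_by_single:
  "mdeg I \<le> d \<Longrightarrow> C ^ mdeg I * norm c \<le> K \<Longrightarrow> bounded_by C d K (Poly_Mapping.single I c)"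
  by (simp add: bounded_by_def TR_norm_single)

lemma bounded_by_mono:
  "bounded_by C d K p \<Longrightarrow> d \<le> d' \<Longrightarrow> K \<le> K' \<Longrightarrow> bounded_by C d' K' p"
  unfolding bounded_by_def by force

lemma bounded_by_add:
  assumes "C \<ge> 0" "bounded_by C d K p" "bounded_by C d L q"
  shows "bounded_by C d (K + L) (p + q)"
  using assms TR_norm_triangle[OF assms(1), of 0 p q] keys_add[of p q]
  unfolding bounded_by_def by fastforce

lemma bounded_by_mult:
  assumes "C \<ge> 0" "bounded_by C d K p" "bounded_by C e L q"
  shows "bounded_by C (d + e) (K * L) (p * q)"
  unfolding bounded_by_def
proof
  show "\<forall>I\<in>Poly_Mapping.keys (p * q). mdeg I \<le> d + e"
    using keys_mult[of p q] assms by (fastforce simp: bounded_by_def mdeg_add intro: add_mono)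
  have "TR_norm 0 C p * TR_norm 0 C q \<le> K * L"
    using assms TR_norm_nonneg[OF assms(1)]
    by (intro mult_mono) (auto simp: bounded_by_def intro: order_trans)
  then show "TR_norm 0 C (p * q) \<le> K * L"
    using TR_norm_0_mult[OF assms(1)] order_trans by blast
qed

lemma bounded_by_one: "bounded_by C 0 1 1"
  using bounded_by_single[of 0 0 C 1 1] by (simp add: mdeg_zero)

lemma bounded_by_power:
  assumes "C \<ge> 0" "bounded_by C d K p"
  shows "bounded_by C (n * d) (K ^ n) (p ^ n)"
  by (induction n) (use bounded_by_one bounded_by_mult[OF assms] in auto)

text \<open>Controls the substitution of the \<open>b i\<close> into a monomial with exponents
  \<open>e i\<close>.\<close>

lemma bounded_by_prod_power:
  assumes "C \<ge> 0" "\<And>i. i \<in> A \<Longrightarrow> bounded_by C d K (b i)"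
  shows "bounded_by C ((\<Sum>i\<in>A. e i) * d) (K ^ (\<Sum>i\<in>A. e i)) (\<Prod>i\<in>A. b i ^ e i)"
  using assms(2)
proof (induction A rule: infinite_finite_induct)
  case (insert a A)
  then have "bounded_by C (e a * d + (\<Sum>i\<in>A. e i) * d) (K ^ e a * K ^ (\<Sum>i\<in>A. e i))
      (b a ^ e a * (\<Prod>i\<in>A. b i ^ e i))"
    using assms(1) by (intro bounded_by_mult bounded_by_power) auto
  then show ?case
    using insert by (simp add: power_add distrib_right)
qed (use bounded_by_one in auto)

text \<open>As \<open>R \<ge> 0\<close>, every factorial weight is at most the one in degree
  \<open>d\<close>; what remains is the norm for \<open>R = 0\<close>.\<close>

lemma TR_norm_le_of_bounded_by:
  assumes "C \<ge> 0" "R \<ge> 0" "bounded_by C d K p"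
  shows "TR_norm R C p \<le> fact d powr R * K"
proof -
  have "TR_norm R C p \<le> fact d powr R * TR_norm 0 C p"
    unfolding TR_norm_def sum_distrib_left
  proof (intro sum_mono)
    fix I assume "I \<in> Poly_Mapping.keys p"
    then have "mdeg I \<le> d" using assms(3) by (simp add: bounded_by_def)
    then have "fact (mdeg I) powr R \<le> fact d powr R"
      using assms(2) by (intro powr_mono2) (auto intro: fact_mono)
    then show "fact (mdeg I) powr R * C ^ mdeg I * norm (Poly_Mapping.lookup p I)
        \<le> fact d powr R * (fact (mdeg I) powr 0 * C ^ mdeg I * norm (Poly_Mapping.lookup p I))"
      using assms(1) by (simp add: mult.assoc mult_right_mono)
  qed
  also have "\<dots> \<le> fact d powr R * K"
    using assms(3) by (simp add: bounded_by_def mult_left_mono)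
  finally show ?thesis .
qed


section \<open>Linear extension from monomials\<close>

text \<open>Only linearity is built in: the lift of the inverse will not be multiplicative.\<close>

definition linear_extension ::
    "(('n::finite \<Rightarrow>\<^sub>0 nat) \<Rightarrow> 'm::finite sym_alg) \<Rightarrow> 'n sym_alg \<Rightarrow> 'm sym_alg" where
  "linear_extension g p = (\<Sum>I\<in>Poly_Mapping.keys p. scalar (Poly_Mapping.lookup p I) * g I)"

lemma linear_extension_superset:
  assumes "finite S" "Poly_Mapping.keys p \<subseteq> S"
  shows "linear_extension g p = (\<Sum>I\<in>S. scalar (Poly_Mapping.lookup p I) * g I)"
  unfolding linear_extension_def using assms
  by (intro sum.mono_neutral_left) (auto simp: in_keys_iff scalar_def)

lemma linear_extension_add:
  "linear_extension g (p + q) = linear_extension g p + linear_extension g q"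
proof -
  let ?S = "Poly_Mapping.keys p \<union> Poly_Mapping.keys q"
  have "Poly_Mapping.keys (p + q) \<subseteq> ?S" by (rule keys_add)
  then show ?thesis
    by (simp add: linear_extension_superset[of ?S] lookup_add scalar_def single_add distrib_right
        sum.distrib)
qed

lemma eval_sum: "eval x (\<Sum>a\<in>A. f a) = (\<Sum>a\<in>A. eval x (f a))"
  by (induction A rule: infinite_finite_induct) (simp_all add: eval_zero eval_add)

lemma eval_one: "eval x 1 = 1"
  using eval_scalar[of x 1] by (simp add: scalar_def)

lemma eval_power: "eval x (p ^ n) = eval x p ^ n"
  by (induction n) (simp_all add: eval_one eval_mult)

lemma eval_prod: "eval x (\<Prod>a\<in>A. f a) = (\<Prod>a\<in>A. eval x (f a))"
  by (induction A rule: infinite_finite_induct) (simp_all add: eval_one eval_mult)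

text \<open>The hypothesis ranges over the monomials of \<open>p\<close> only, since the lift of the
  inverse has the right values just on those occurring in \<open>R_C2\<close>.\<close>

lemma eval_linear_extension:
  assumes "\<And>I. I \<in> Poly_Mapping.keys p \<Longrightarrow>
    eval y (g I) = (\<Prod>i\<in>UNIV. x i ^ Poly_Mapping.lookup I i)"
  shows "eval y (linear_extension g p) = eval x p"
  unfolding linear_extension_def eval_sum eval_def[of x p]
  by (intro sum.cong) (simp_all add: eval_mult eval_scalar assms)

text \<open>The \<open>TR_norm\<close>s are weighted 1-norms, so a linear map is bounded as soon as
  it is bounded on monomials.\<close>

lemma TR_norm_linear_extension:
  assumes "C \<ge> 0" "\<And>I. TR_norm R C (g I) \<le> fact (mdeg I) powr R' * C' ^ mdeg I"
  shows "TR_norm R C (linear_extension g p) \<le> TR_norm R' C' p"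
proof -
  have "TR_norm R C (linear_extension g p)
      \<le> (\<Sum>I\<in>Poly_Mapping.keys p. TR_norm R C (scalar (Poly_Mapping.lookup p I) * g I))"
    unfolding linear_extension_def by (rule TR_norm_sum[OF assms(1)])
  also have "\<dots> \<le> (\<Sum>I\<in>Poly_Mapping.keys p.
      norm (Poly_Mapping.lookup p I) * (fact (mdeg I) powr R' * C' ^ mdeg I))"
    by (intro sum_mono order_trans[OF TR_norm_scalar_mult[OF assms(1)]] mult_left_mono assms(2))
      simp
  also have "\<dots> = TR_norm R' C' p"
    by (simp add: TR_norm_def mult_ac)
  finally show ?thesis .
qed

lemma openin_TR_ball: "C \<ge> 1 \<Longrightarrow> e > 0 \<Longrightarrow> openin (TR_topology R) {b. TR_norm R C (b - a) < e}"
  unfolding TR_topology_def locally_convex_topology_def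
  by (rule topology_generated_by_Basis) blast

text \<open>The norm bound gives continuity at 0, and additivity translates it to every
  point.\<close>

lemma continuous_map_TR_additive:
  fixes F :: "'n::finite sym_alg \<Rightarrow> 'm::finite sym_alg"
  assumes add: "\<And>p q. F (p + q) = F p + F q"
    and bound: "\<And>C. C \<ge> 1 \<Longrightarrow> \<exists>C'\<ge>1. \<forall>p. TR_norm R C (F p) \<le> TR_norm R' C' p"
  shows "continuous_map (TR_topology R') (TR_topology R) F"
proof -
  have "openin (TR_topology R') (F -` {b. TR_norm R C (b - a) < e})" if C: "C \<ge> 1" for C a e
  proof (subst openin_subopen, intro ballI)
    fix x assume "x \<in> F -` {b. TR_norm R C (b - a) < e}"
    \<comment> \<open>The slack left at \<open>x\<close> is the radius of a ball around
      \<open>x\<close> inside the preimage.\<close>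
    then have d: "e - TR_norm R C (F x - a) > 0" (is "?d > 0") by simp
    obtain C' where C': "C' \<ge> 1" "\<And>p. TR_norm R C (F p) \<le> TR_norm R' C' p"
      using bound[OF C] by blast
    let ?T = "{y. TR_norm R' C' (y - x) < ?d}"
    have "?T \<subseteq> F -` {b. TR_norm R C (b - a) < e}"
    proof
      fix y assume "y \<in> ?T"
      then have "TR_norm R C (F (y - x)) < ?d"
        using C'(2)[of "y - x"] by simp
      moreover have "F (y - x) + (F x - a) = F y - a"
        using add[of "y - x" x] by simp
      then have "TR_norm R C (F y - a) \<le> TR_norm R C (F (y - x)) + TR_norm R C (F x - a)"
        using TR_norm_triangle[of C R "F (y - x)" "F x - a"] C by (metis order_trans zero_le_one)
      ultimately show "y \<in> F -` {b. TR_norm R C (b - a) < e}"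
        by simp
    qed
    moreover have "x \<in> ?T" using d by (simp add: TR_norm_zero)
    ultimately show "\<exists>T. openin (TR_topology R') T \<and> x \<in> T \<and> T \<subseteq> F -` {b. TR_norm R C (b - a) < e}"
      using openin_TR_ball[OF C'(1) d] by blast
  qed
  moreover have "topspace (TR_topology R :: 'm sym_alg topology) = UNIV"
    by (rule topspace_TR_topology)
  ultimately show ?thesis
    unfolding TR_topology_def[of R] locally_convex_topology_def
    by (intro continuous_on_generated_topo)
      (auto simp: topspace_TR_topology simp flip: topology_generated_by_topspace)
qed


section \<open>Factorials\<close>

lemma fact_square_le: "(fact n)\<^sup>2 \<le> (fact (2 * n) :: real)"
proof -
  have "fact n * fact n \<le> (fact (n + n) :: nat)"
    by (intro dvd_imp_le fact_fact_dvd_fact) simp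
  then have "real (fact n * fact n) \<le> real (fact (n + n))"
    by (rule of_nat_mono)
  then show ?thesis
    by (simp add: power2_eq_square mult_2)
qed

text \<open>Equivalently, the central binomial coefficient is at most \<open>4 ^ n\<close>; the
  induction step is \<open>(2n+2)(2n+1) \<le> 4(n+1)^2\<close>.\<close>

lemma fact_double_le: "(fact (2 * n) :: real) \<le> 4 ^ n * (fact n)\<^sup>2"
proof (induction n)
  case (Suc n)
  have "(fact (2 * Suc n) :: real) = (2 * real n + 2) * (2 * real n + 1) * fact (2 * n)"
    by (simp add: algebra_simps)
  also have "\<dots> \<le> 4 * (real n + 1)\<^sup>2 * fact (2 * n)"
    by (intro mult_right_mono) (simp_all add: power2_eq_square algebra_simps)
  also have "\<dots> \<le> 4 * (real n + 1)\<^sup>2 * (4 ^ n * (fact n)\<^sup>2)"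
    using Suc by (intro mult_left_mono) auto
  also have "\<dots> = 4 ^ Suc n * (fact (Suc n))\<^sup>2"
    by (simp add: power2_eq_square algebra_simps)
  finally show ?case .
qed simp

lemma fact_powr_double: "fact n powr (2 * R) = ((fact n)\<^sup>2 :: real) powr R"
  using powr_powr[of "fact n :: real" 2 R] by simp

lemma fact_powr_double_le: "R \<ge> 0 \<Longrightarrow> fact n powr (2 * R) \<le> (fact (2 * n) :: real) powr R"
  unfolding fact_powr_double by (intro powr_mono2 fact_square_le) auto

text \<open>The loss is geometric in \<open>n\<close>, so enlarging the constant of the norm absorbs
  it.\<close>

lemma fact_double_powr_le:
  assumes "R \<ge> 0"
  shows "(fact (2 * n) :: real) powr R \<le> fact n powr (2 * R) * (4 powr R) ^ n"
proof -
  have "(fact (2 * n) :: real) powr R \<le> (4 ^ n * (fact n)\<^sup>2) powr R"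
    using assms by (intro powr_mono2 fact_double_le) auto
  moreover have "(4 ^ n :: real) powr R = (4 powr R) ^ n"
    by (simp add: powr_powr mult.commute flip: powr_realpow)
  then have "(4 ^ n * (fact n)\<^sup>2) powr R = fact n powr (2 * R) * (4 powr R) ^ n"
    by (simp add: powr_mult fact_powr_double)
  ultimately show ?thesis by simp
qed


section \<open>Lifting the identification\<close>

fun sphere_gen :: "real \<Rightarrow> sl2_gen \<Rightarrow> C2_gen sym_alg" where
  "sphere_gen lam Hf = scalar (\<i> * lam) * (gen U_hat * gen Ubar_hat - gen V_hat * gen Vbar_hat)"
| "sphere_gen lam Xf = scalar (\<i> * lam) * (gen Ubar_hat * gen V_hat)"
| "sphere_gen lam Yf = scalar (\<i> * lam) * (gen U_hat * gen Vbar_hat)"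

definition lift_to_C2 :: "real \<Rightarrow> sl2_gen sym_alg \<Rightarrow> C2_gen sym_alg" where
  "lift_to_C2 lam = linear_extension (\<lambda>I. \<Prod>i\<in>UNIV. sphere_gen lam i ^ Poly_Mapping.lookup I i)"

lemma generated_algebra_power:
  assumes "\<iota> 1 = 1" "a \<in> generated_algebra \<iota> S"
  shows "a ^ n \<in> generated_algebra \<iota> S"
proof (induction n)
  case 0
  then show ?case
    using generated_algebra.scalar[of \<iota> 1 S] assms(1) by simp
qed (simp add: assms(2) generated_algebra.mult)

text \<open>The reduction topology is a quotient of the subspace \<open>R_C2\<close>, so the lift
  has to land there.\<close>

lemma lift_to_C2_in_R_C2: "lift_to_C2 lam p \<in> R_C2"
proof -
  have one: "scalar 1 = (1 :: C2_gen sym_alg)" and zero: "0 = (scalar 0 :: C2_gen sym_alg)"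
    by (simp_all add: scalar_def)
  have base: "sphere_gen lam i \<in> R_C2" for i
    by (cases i)
      (auto simp: R_C2_def intro!: generated_algebra.scalar intro: generated_algebra.gen generated_algebra.mult)
  have "(\<Prod>i\<in>UNIV. sphere_gen lam i ^ Poly_Mapping.lookup I i) \<in> R_C2" for I
    using base generated_algebra_power[where \<iota> = scalar, OF one] unfolding UNIV_sl2_gen R_C2_def
    by (auto intro!: generated_algebra.mult simp del: sphere_gen.simps)
  moreover have "(\<Sum>I\<in>A. f I) \<in> R_C2" if "\<And>I. f I \<in> R_C2" for f :: "_ \<Rightarrow> C2_gen sym_alg" and A
    using that by (induction A rule: infinite_finite_induct)
      (auto simp: R_C2_def zero intro: generated_algebra.scalar generated_algebra.add)
  moreover have "scalar c * q \<in> R_C2" if "q \<in> R_C2" for c q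
    using that by (auto simp: R_C2_def intro: generated_algebra.scalar generated_algebra.mult)
  ultimately show ?thesis
    unfolding lift_to_C2_def linear_extension_def by meson
qed

text \<open>Both sides are evaluations at points of \<open>SU2\<close>, and \<open>flat_psi\<close>
  matches them on generators.\<close>

lemma C2_to_SU2_lift_to_C2:
  "C2_to_SU2 (lift_to_C2 lam p) = identification lam (sl2_to_S2 lam p)"
proof -
  have "eval (C2_fun (entry_u k, entry_v k)) (lift_to_C2 lam p) = sl2_poly p (psi lam k)"
    if k: "k \<in> SU2" for k
  proof -
    have "eval (C2_fun (entry_u k, entry_v k)) (sphere_gen lam g) = flat (sl2_basis g) (psi lam k)" for g
      by (cases g) (simp_all add: flat_psi[OF k] eval_mult eval_diff eval_gen eval_scalar fun_A_def
          fun_B_def fun_C_def complex_norm_square del: sl2_basis.simps of_real_power)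
    then show ?thesis
      unfolding lift_to_C2_def sl2_poly_def
      by (intro eval_linear_extension) (simp add: eval_prod eval_power)
  qed
  then show ?thesis
    by (auto simp: C2_to_SU2_def identification_def sl2_to_S2_def S2_def fun_eq_iff)
qed

lemma bounded_by_gen: "C \<ge> 1 \<Longrightarrow> bounded_by C 1 C (gen i)"
  unfolding gen_def by (rule bounded_by_single) (auto simp: mdeg_single)

lemma bounded_by_scalar: "bounded_by C 0 (norm c) (scalar c)"
  unfolding scalar_def by (rule bounded_by_single) (auto simp: mdeg_zero)

lemma bounded_by_uminus: "bounded_by C d K (- p) \<longleftrightarrow> bounded_by C d K p"
  by (simp add: bounded_by_def TR_norm_def)

lemma continuous_map_lift_to_C2:
  assumes "lam > 0" "R \<ge> 0"
  shows "continuous_map (TR_topology (2 * R)) (TR_topology R) (lift_to_C2 lam)"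
proof (rule continuous_map_TR_additive)
  fix C :: real assume C: "C \<ge> 1"
  \<comment> \<open>The worst generator is the image of \<open>Hf\<close>, with two quadratic
    monomials of norm \<open>C * C\<close> each.\<close>
  define K where "K = lam * (C * C + C * C)"
  \<comment> \<open>The factor \<open>4 powr R\<close> pays for the doubled degree; the maximum
    keeps the constant admissible.\<close>
  define C' where "C' = max 1 (4 powr R * K)"
  have m: "bounded_by C 2 (C * C) (gen i * gen j)" for i j :: C2_gen
    using bounded_by_mult[OF _ bounded_by_gen[OF C] bounded_by_gen[OF C], of i j] C
    by (simp add: numeral_2_eq_2)
  have s: "bounded_by C 2 (lam * M) (scalar (\<i> * lam) * q)"
    if "bounded_by C 2 M q" for M and q :: "C2_gen sym_alg"
    using bounded_by_mult[OF _ bounded_by_scalar that, of "\<i> * lam"] C assms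
    by (simp add: norm_mult numeral_2_eq_2)
  have base: "bounded_by C 2 K (sphere_gen lam g)" for g
  proof (cases g)
    case Hf
    have "bounded_by C 2 (C * C + C * C)
        (gen U_hat * gen Ubar_hat + - (gen V_hat * gen Vbar_hat))"
      using C by (intro bounded_by_add m iffD2[OF bounded_by_uminus]) simp
    then show ?thesis using s Hf by (simp add: K_def)
  next
    case Xf
    then show ?thesis
      using bounded_by_mono[OF s[OF m], of 2 K] assms by (simp add: K_def mult_left_mono)
  next
    case Yf
    then show ?thesis
      using bounded_by_mono[OF s[OF m], of 2 K] assms by (simp add: K_def mult_left_mono)
  qed
  have K0: "K \<ge> 0" using assms by (simp add: K_def)
  have "TR_norm R C (\<Prod>i\<in>UNIV. sphere_gen lam i ^ Poly_Mapping.lookup I i)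
      \<le> fact (mdeg I) powr (2 * R) * C' ^ mdeg I" for I
  proof -
    have "TR_norm R C (\<Prod>i\<in>UNIV. sphere_gen lam i ^ Poly_Mapping.lookup I i)
        \<le> fact (mdeg I * 2) powr R * K ^ mdeg I"
      unfolding mdeg_def using C assms base
      by (intro TR_norm_le_of_bounded_by bounded_by_prod_power) auto
    also have "\<dots> \<le> fact (mdeg I) powr (2 * R) * (4 powr R) ^ mdeg I * K ^ mdeg I"
      using fact_double_powr_le[OF assms(2), of "mdeg I"] K0
      by (intro mult_right_mono) (auto simp: mult.commute)
    also have "\<dots> \<le> fact (mdeg I) powr (2 * R) * C' ^ mdeg I"
      using K0 by (auto simp: C'_def mult.assoc simp flip: power_mult_distrib
          intro!: mult_left_mono power_mono)
    finally show ?thesis .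
  qed
  then have "\<forall>p. TR_norm R C (lift_to_C2 lam p) \<le> TR_norm (2 * R) C' p"
    using C unfolding lift_to_C2_def by (intro allI TR_norm_linear_extension) auto
  then show "\<exists>C'\<ge>1. \<forall>p. TR_norm R C (lift_to_C2 lam p) \<le> TR_norm (2 * R) C' p"
    by (intro exI[of _ C']) (simp add: C'_def)
qed (simp add: lift_to_C2_def linear_extension_add)


section \<open>Lifting the inverse\<close>

text \<open>These are the monomials invariant under the diagonal circle action
  \<open>(z1, z2) \<mapsto> (e^(it) z1, e^(it) z2)\<close>.\<close>

definition balanced :: "(C2_gen \<Rightarrow>\<^sub>0 nat) \<Rightarrow> bool" where
  "balanced I \<longleftrightarrow> Poly_Mapping.lookup I U_hat + Poly_Mapping.lookup I V_hat
     = Poly_Mapping.lookup I Ubar_hat + Poly_Mapping.lookup I Vbar_hat"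

lemma R_C2_balanced: "p \<in> R_C2 \<Longrightarrow> I \<in> Poly_Mapping.keys p \<Longrightarrow> balanced I"
  unfolding R_C2_def
proof (induction p arbitrary: I rule: generated_algebra.induct)
  case (scalar c)
  then show ?case by (auto simp: scalar_def balanced_def split: if_splits)
next
  case (gen a)
  have b: "balanced J" if "J \<in> Poly_Mapping.keys (Defs.gen i * Defs.gen j)"
    "(i, j) \<in> {U_hat, V_hat} \<times> {Ubar_hat, Vbar_hat} \<union> {Ubar_hat, Vbar_hat} \<times> {U_hat, V_hat}"
    for i j J
    using that by (auto simp: Defs.gen_def mult_single balanced_def lookup_add lookup_single)
  obtain i j where "I \<in> Poly_Mapping.keys (Defs.gen i * Defs.gen j)"
    "(i, j) \<in> {U_hat, V_hat} \<times> {Ubar_hat, Vbar_hat} \<union> {Ubar_hat, Vbar_hat} \<times> {U_hat, V_hat}"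
    using gen keys_add[of "Defs.gen U_hat * Defs.gen Ubar_hat" "Defs.gen V_hat * Defs.gen Vbar_hat"]
      keys_diff[of "Defs.gen U_hat * Defs.gen Ubar_hat" "Defs.gen V_hat * Defs.gen Vbar_hat"]
    by blast
  then show ?case by (rule b)
next
  case (add a b)
  then show ?case using keys_add[of a b] by blast
next
  case (mult a b)
  then show ?case using keys_mult[of a b] by (force simp: balanced_def lookup_add)
qed

text \<open>Truncated subtraction: at most one of the last two exponents is nonzero.\<close>

definition balanced_image :: "real \<Rightarrow> (C2_gen \<Rightarrow>\<^sub>0 nat) \<Rightarrow> sl2_gen sym_alg" where
  "balanced_image lam I = (let e = Poly_Mapping.lookup I in
     if balanced I then
       (scalar (1/2) + scalar (1 / (2 * \<i> * lam)) * gen Hf) ^ min (e U_hat) (e Ubar_hat) *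
       (scalar (1/2) + scalar (- 1 / (2 * \<i> * lam)) * gen Hf) ^ min (e V_hat) (e Vbar_hat) *
       (scalar (1 / (\<i> * lam)) * gen Xf) ^ (e Ubar_hat - e U_hat) *
       (scalar (1 / (\<i> * lam)) * gen Yf) ^ (e U_hat - e Ubar_hat)
     else 0)"

text \<open>Not multiplicative: the product of \<open>Ubar_hat V_hat\<close> and
  \<open>U_hat Vbar_hat\<close> goes to a polynomial in \<open>Hf\<close>, not to a multiple of
  \<open>gen Xf * gen Yf\<close>. The two agree only on the sphere.\<close>

definition lift_to_sl2 :: "real \<Rightarrow> C2_gen sym_alg \<Rightarrow> sl2_gen sym_alg" where
  "lift_to_sl2 lam = linear_extension (balanced_image lam)"

lemma identification_lift_to_sl2:
  assumes "lam > 0" "p \<in> R_C2"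
  shows "identification lam (sl2_to_S2 lam (lift_to_sl2 lam p)) = C2_to_SU2 p"
proof -
  have "sl2_poly (lift_to_sl2 lam p) (psi lam k) = eval (C2_fun (entry_u k, entry_v k)) p"
    if k: "k \<in> SU2" for k
    unfolding lift_to_sl2_def sl2_poly_def
  proof (rule eval_linear_extension)
    fix I assume "I \<in> Poly_Mapping.keys p"
    then have bal: "balanced I" using R_C2_balanced assms(2) by blast
    let ?e = "Poly_Mapping.lookup I"
    define u v where "u = entry_u k" and "v = entry_v k"
    have uv: "u * cnj u + v * cnj v = 1"
      using SU2_entries(3)[OF k] by (simp add: u_def v_def entry_u_def entry_v_def)
    have A: "fun_A k = u * cnj u - v * cnj v"
      by (simp add: fun_A_def u_def v_def complex_norm_square del: of_real_power)
    have u: "u * cnj u = 1 - v * cnj v"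
      using uv by (simp add: algebra_simps)
    \<comment> \<open>Here the equation of \<open>SU2\<close> enters: it makes the squared moduli
      affine in \<open>fun_A\<close>.\<close>
    have pm: "1/2 + fun_A k / 2 = u * cnj u" "1/2 - fun_A k / 2 = v * cnj v"
      unfolding A u by (simp_all add: field_simps)
    have "eval (\<lambda>g. flat (sl2_basis g) (psi lam k)) (balanced_image lam I)
      = (1/2 + fun_A k / 2) ^ min (?e U_hat) (?e Ubar_hat) *
        (1/2 - fun_A k / 2) ^ min (?e V_hat) (?e Vbar_hat) *
        fun_B k ^ (?e Ubar_hat - ?e U_hat) * fun_C k ^ (?e U_hat - ?e Ubar_hat)"
      using bal assms(1)
      by (simp add: balanced_image_def Let_def eval_mult eval_power eval_add eval_scalar eval_gen
          flat_psi[OF k] del: sl2_basis.simps)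
    also have "\<dots> = u ^ ?e U_hat * cnj u ^ ?e Ubar_hat * (v ^ ?e V_hat * cnj v ^ ?e Vbar_hat)"
    \<comment> \<open>Balance forces the excess of \<open>Ubar_hat\<close> over \<open>U_hat\<close>
      to equal that of \<open>V_hat\<close> over \<open>Vbar_hat\<close>, so the unpaired variables
      form a power of \<open>fun_B\<close>, or of \<open>fun_C\<close> if the excess is
      negative.\<close>
    proof (cases "?e U_hat \<le> ?e Ubar_hat")
      case True
      then obtain d where "?e Ubar_hat = ?e U_hat + d" "?e V_hat = ?e Vbar_hat + d"
        using that[of "?e Ubar_hat - ?e U_hat"] bal unfolding balanced_def by linarith
      then show ?thesis
        by (simp add: pm fun_B_def power_mult_distrib power_add mult_ac flip: u_def v_def)
    next
      case False
      then obtain d where "?e U_hat = ?e Ubar_hat + d" "?e Vbar_hat = ?e V_hat + d"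
        using that[of "?e U_hat - ?e Ubar_hat"] bal unfolding balanced_def by linarith
      then show ?thesis
        by (simp add: pm fun_C_def power_mult_distrib power_add mult_ac flip: u_def v_def)
    qed
    also have "\<dots> = (\<Prod>i\<in>UNIV. C2_fun (entry_u k, entry_v k) i ^ ?e i)"
      by (simp add: UNIV_C2_gen u_def v_def mult_ac)
    finally show "eval (\<lambda>g. flat (sl2_basis g) (psi lam k)) (balanced_image lam I)
      = (\<Prod>i\<in>UNIV. C2_fun (entry_u k, entry_v k) i ^ ?e i)" .
  qed
  then show ?thesis
    by (auto simp: C2_to_SU2_def identification_def sl2_to_S2_def S2_def fun_eq_iff)
qed

lemma continuous_map_lift_to_sl2:
  assumes "lam > 0" "R \<ge> 0"
  shows "continuous_map (TR_topology R) (TR_topology (2 * R)) (lift_to_sl2 lam)"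
proof (rule continuous_map_TR_additive)
  fix C :: real assume C: "C \<ge> 1"
  \<comment> \<open>The term \<open>C / lam\<close> covers the linear parts; the 1 covers the
    constant 1/2 and gives \<open>K \<ge> 1\<close>.\<close>
  define K where "K = 1 + C / lam"
  have K1: "K \<ge> 1" using assms C by (simp add: K_def)
  have s: "bounded_by C 1 (norm c * C) (scalar c * gen i)" for c and i :: sl2_gen
    using bounded_by_mult[OF _ bounded_by_scalar bounded_by_gen[OF C], of c i] C by simp
  have affine: "bounded_by C 1 K (scalar (1/2) + scalar c * gen i)"
    if "norm c \<le> 1 / lam" for c and i :: sl2_gen
  proof -
    have "bounded_by C 1 (1/2) (scalar (1/2) :: sl2_gen sym_alg)"
      using bounded_by_mono[OF bounded_by_scalar[of C "1/2"], of 1 "1/2"] by simp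
    then have "bounded_by C 1 (1/2 + norm c * C) (scalar (1/2) + scalar c * gen i)"
      using C s by (intro bounded_by_add) auto
    moreover have "norm c * C \<le> C / lam"
      using mult_right_mono[OF that, of C] C by simp
    ultimately show ?thesis
      by (auto intro: bounded_by_mono simp: K_def)
  qed
  have lin: "bounded_by C 1 K (scalar (1 / (\<i> * lam)) * gen i)" for i :: sl2_gen
    using assms C by (intro bounded_by_mono[OF s]) (auto simp: K_def norm_divide norm_mult)
  have "TR_norm (2 * R) C (balanced_image lam I) \<le> fact (mdeg I) powr R * K ^ mdeg I" for I
  \<comment> \<open>Unbalanced monomials go to 0, so the bound holds on the whole polynomial
    algebra, not just on \<open>R_C2\<close>.\<close>
  proof (cases "balanced I")
    case False
    then show ?thesis using K1 by (simp add: balanced_image_def TR_norm_zero)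
  next
    case True
    let ?e = "Poly_Mapping.lookup I"
    define n where "n = ?e U_hat + ?e V_hat"
    have deg: "mdeg I = 2 * n"
      using True by (simp add: mdeg_def n_def balanced_def UNIV_C2_gen)
    \<comment> \<open>The four exponents in \<open>balanced_image\<close> add up to half the degree,
      which is what allows \<open>2 * R\<close> on the target side.\<close>
    have n: "min (?e U_hat) (?e Ubar_hat) + min (?e V_hat) (?e Vbar_hat)
        + (?e Ubar_hat - ?e U_hat) + (?e U_hat - ?e Ubar_hat) = n"
      using True by (auto simp: balanced_def n_def)
    have c: "norm (1 / (2 * \<i> * lam)) \<le> 1 / lam" "norm (- 1 / (2 * \<i> * lam)) \<le> 1 / lam"
      using assms by (simp_all add: norm_divide norm_mult field_simps)
    have pw: "bounded_by C m (K ^ m) (q ^ m)" if "bounded_by C 1 K q"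
      for m and q :: "sl2_gen sym_alg"
      using bounded_by_power[OF _ that, of m] C by simp
    have "bounded_by C n (K ^ n) (balanced_image lam I)"
      unfolding balanced_image_def Let_def if_P[OF True] n[symmetric] power_add
      using C by (intro bounded_by_mult pw affine lin c) auto
    then have "TR_norm (2 * R) C (balanced_image lam I) \<le> fact n powr (2 * R) * K ^ n"
      using C assms by (intro TR_norm_le_of_bounded_by) auto
    also have "\<dots> \<le> fact (2 * n) powr R * K ^ (2 * n)"
      using K1 fact_powr_double_le[OF assms(2)] by (intro mult_mono power_increasing) auto
    finally show ?thesis by (simp add: deg)
  qed
  then have "\<forall>p. TR_norm (2 * R) C (lift_to_sl2 lam p) \<le> TR_norm R K p"
    using C unfolding lift_to_sl2_def by (intro allI TR_norm_linear_extension) auto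
  then show "\<exists>C'\<ge>1. \<forall>p. TR_norm (2 * R) C (lift_to_sl2 lam p) \<le> TR_norm R C' p"
    using K1 by blast
qed (simp add: lift_to_sl2_def linear_extension_add)


section \<open>The homeomorphism\<close>

lemma inj_on_identification: "inj_on (identification lam) (Pol_S2 lam)"
proof (rule inj_onI)
  fix f g assume f: "f \<in> Pol_S2 lam" and g: "g \<in> Pol_S2 lam"
    and eq: "identification lam f = identification lam g"
  have "f (psi lam k) = g (psi lam k)" if "k \<in> SU2" for k
    using fun_cong[OF eq, of k] that by (simp add: identification_def)
  moreover have "f \<in> extensional (S2 lam)" "g \<in> extensional (S2 lam)"
    using f g by (auto simp: Pol_S2_def)
  ultimately show "f = g"
    by (auto intro!: extensionalityI simp: S2_def)
qed

text \<open>The homeomorphism also contains the bijectivity of the identification.\<close>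

theorem proposition5p14:
  fixes lam R :: real
  assumes "lam > 0" and "R \<ge> 0"
  shows "homeomorphic_map (quotient_TR_topology lam (2 * R)) (reduction_TR_topology R)
    (identification lam)"
proof -
  let ?X = "quotient_TR_topology lam (2 * R)" and ?Y = "reduction_TR_topology R"
  let ?P = "TR_topology (2 * R) :: sl2_gen sym_alg topology"
  let ?Q = "subtopology (TR_topology R) R_C2"
  have qX: "quotient_map ?P ?X (sl2_to_S2 lam)"
    and qY: "quotient_map ?Q ?Y C2_to_SU2"
    by (rule quotient_map_quotient quotient_map_reduction)+
  have "continuous_map ?P ?Q (lift_to_C2 lam)"
    using continuous_map_lift_to_C2[OF assms] lift_to_C2_in_R_C2
    by (auto simp: continuous_map_in_subtopology)
  then have "continuous_map ?P ?Y (C2_to_SU2 \<circ> lift_to_C2 lam)"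
    using quotient_imp_continuous_map[OF qY] by (rule continuous_map_compose)
  then have "continuous_map ?P ?Y (identification lam \<circ> sl2_to_S2 lam)"
    by (simp add: C2_to_SU2_lift_to_C2 comp_def)
  \<comment> \<open>Universal property of the quotient by restriction to the sphere.\<close>
  then have cont: "continuous_map ?X ?Y (identification lam)"
    using continuous_compose_quotient_map[OF qX] by blast
  have cont': "continuous_map ?Q ?X (sl2_to_S2 lam \<circ> lift_to_sl2 lam)"
    using continuous_map_lift_to_sl2[OF assms] quotient_imp_continuous_map[OF qX]
    by (intro continuous_map_compose continuous_map_from_subtopology)
  \<comment> \<open>On \<open>R_C2\<close> this composite is \<open>C2_to_SU2\<close>. If a
    composite of continuous maps is a quotient map, so is its outer factor; the inverse of the
    identification need not be constructed.\<close>
  have "quotient_map ?Q ?Y (identification lam \<circ> (sl2_to_S2 lam \<circ> lift_to_sl2 lam))"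
    using qY identification_lift_to_sl2[OF assms(1)]
    by (elim quotient_map_eq) (auto simp: topspace_TR_topology)
  then have "quotient_map ?X ?Y (identification lam)"
    by (rule quotient_map_from_composition[OF cont' cont])
  then show ?thesis
    using inj_on_identification by (simp add: homeomorphic_map_def quotient_map_quotient)
qed

end
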